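(* Let $T\in\mathcal{TO}_2$. Then $|T|=1$, i.e. the (minimal) transducer $T$ has exactly one state.
   Context: Words. $X_2=\{0,1\}$; $X_2^*$ is the set of finite words over $X_2$ ($\varepsilon$ the empty word); $X_2^\omega$ is the set of infinite sequences with the product topology and the lexicographic order induced by $0<1$. Transducers. A transducer (over $X_2$) is $T=(X_2,Q_T,\pi_T,\lambda_T)$ with $Q_T$ a countable set of states, $\pi_T:X_2\times Q_T\to Q_T$ and $\lambda_T:X_2\times Q_T\to X_2^*$. These are extended to finite words by $\pi_T(\varepsilon,q)=q$, $\lambda_T(\varepsilon,q)=\varepsilon$, $\pi_T(wa,q)=\pi_T(a,\pi_T(w,q))$, $\lambda_T(wa,q)=\lambda_T(w,q)\lambda_T(a,\pi_T(w,q))$, and $\lambda_T$ is extended to infinite words by concatenating outputs. It is always assumed that every infinite input, read from any state, gives an infinite output. For $q\in Q_T$ let $h_q:X_2^\omega\to X_2^\omega$, $h_q(w)=\lambda_T(w,q)$, and $\mathrm{im}(q)=h_q(X_2^\omega)$. Two states are $\omega$-equivalent if they induce the same map. A state $q$ is a state of incomplete response if the longest common prefix $\Lambda(\varepsilon,q)$ of $\mathrm{im}(q)$ is non-empty. $T$ is minimal if no two distinct states are $\omega$-equivalent, there are no states of incomplete response, and $T$ is strongly connected as a directed graph. Transducers that agree up to a bijection of states preserving the induced maps are identified. $T$ is strongly synchronizing if for some $k$, for every word $w$ of length $k$, $\pi_T(w,q)$ does not depend on $q$; the states of the form $\pi_T(w,q)$, $|w|=k$, form the core of $T$ (a subtransducer),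 and $T$ is core if it equals its core. $|T|$ denotes the number of states. Groups. $\mathcal{SO}_2$ is the set of minimal, strongly synchronizing, core transducers $T$ over $X_2$ such that for every $t\in Q_T$ the map $h_t$ is injective with clopen image. The product $T*U$ has state set $Q_T\times Q_U$, $\pi_{T*U}(x,(p,q))=(\pi_T(x,p),\pi_U(\lambda_T(x,p),q))$, $\lambda_{T*U}(x,(p,q))=\lambda_U(\lambda_T(x,p),q)$. For $T,U\in\mathcal{SO}_2$, $TU\in\mathcal{SO}_2$ is obtained from the core of $T*U$ by removing incomplete response (replacing each output $\lambda(a,q)$ by the word obtained from $\lambda(a,q)\Lambda(\varepsilon,\pi(a,q))$ by deleting its prefix $\Lambda(\varepsilon,q)$), identifying $\omega$-equivalent states, and taking the core. This makes $\mathcal{SO}_2$ a monoid whose identity is the single-state identity transducer, and $\mathcal{O}_2$ is its largest inverse-closed subset (its group of units). $\mathcal{TO}_2$ is the group of all $T\in\mathcal{O}_2$ such that either every $h_t$ ($t\in Q_T$) preserves the lexicographic order or every $h_t$ reverses it. (It is known that $\mathcal{TO}_2\cong\mathrm{Out}(T)$ for Thompson's group $T$.) *)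

theory Defs
  imports
    "HOL-Analysis.Function_Topology"
    "HOL-Library.Countable_Set"
    "HOL-Library.Fun_Lexorder"
begin

text \<open>
  The alphabet \<open>{0,1}\<close> is \<^typ>\<open>bool\<close>, with \<^term>\<open>False\<close> for \<open>0\<close> and \<^term>\<open>True\<close> for \<open>1\<close>; finite words
  are lists. On infinite words \<^typ>\<open>nat \<Rightarrow> bool\<close> the class \<open>topological_space\<close> supplies the product
  topology, but the class order \<open><\<close> is pointwise: the lexicographic order is \<^const>\<open>less_fun\<close>.
\<close>

type_synonym word = "bool list"
type_synonym seq = "nat \<Rightarrow> bool"

definition seq_prefix :: "nat \<Rightarrow> seq \<Rightarrow> word" where
  "seq_prefix n x = map x [0..<n]"

record 's transducer =
  states :: "'s set"
  step :: "bool \<Rightarrow> 's \<Rightarrow> 's"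
  out :: "bool \<Rightarrow> 's \<Rightarrow> word"

primrec step_word :: "'s transducer \<Rightarrow> word \<Rightarrow> 's \<Rightarrow> 's" where
  "step_word T [] q = q"
| "step_word T (a # w) q = step_word T w (step T a q)"

primrec out_word :: "'s transducer \<Rightarrow> word \<Rightarrow> 's \<Rightarrow> word" where
  "out_word T [] q = []"
| "out_word T (a # w) q = out T a q @ out_word T w (step T a q)"

lemma step_word_snoc: "step_word T (w @ [a]) q = step T a (step_word T w q)"
  by (induction w arbitrary: q) simp_all

lemma out_word_snoc: "out_word T (w @ [a]) q = out_word T w q @ out T a (step_word T w q)"
  by (induction w arbitrary: q) simp_all

definition transducer :: "'s transducer \<Rightarrow> bool" where
  "transducer T \<longleftrightarrow>
     countable (states T) \<and> states T \<noteq> {} \<and>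
     (\<forall>a. \<forall>q \<in> states T. step T a q \<in> states T) \<and>
     (\<forall>q \<in> states T. \<forall>x. \<forall>m. \<exists>n. m \<le> length (out_word T (seq_prefix n x) q))"

text \<open>
  \<open>induced T q\<close> is $h_q$. Its \<open>i\<close>-th letter is read off the output of any finite prefix of the input
  that is long enough to produce it; the outputs of longer prefixes extend those of shorter ones.
\<close>

definition induced :: "'s transducer \<Rightarrow> 's \<Rightarrow> seq \<Rightarrow> seq" where
  "induced T q x = (\<lambda>i.
     out_word T (seq_prefix (LEAST n. i < length (out_word T (seq_prefix n x) q)) x) q ! i)"

definition omega_equiv :: "'s transducer \<Rightarrow> ('s \<times> 's) set" where
  "omega_equiv T = {(p, q). p \<in> states T \<and> q \<in> states T \<and> induced T p = induced T q}"

definition common_prefix :: "word \<Rightarrow> seq set \<Rightarrow> bool" where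
  "common_prefix w S \<longleftrightarrow> (\<forall>x \<in> S. seq_prefix (length w) x = w)"

text \<open>
  \<open>Lambda T q\<close> is $\Lambda(\varepsilon,q)$. It is meaningful when \<^term>\<open>induced T q\<close> is not constant; for a
  constant map the longest common prefix of the image is an infinite word. Incomplete response is
  stated so as to cover that case, too.
\<close>

definition Lambda :: "'s transducer \<Rightarrow> 's \<Rightarrow> word" where
  "Lambda T q = (ARG_MAX length w. common_prefix w (range (induced T q)))"

definition incomplete_response :: "'s transducer \<Rightarrow> 's \<Rightarrow> bool" where
  "incomplete_response T q \<longleftrightarrow> (\<exists>w. w \<noteq> [] \<and> common_prefix w (range (induced T q)))"

definition strongly_connected :: "'s transducer \<Rightarrow> bool" where
  "strongly_connected T \<longleftrightarrow> (\<forall>p \<in> states T. \<forall>q \<in> states T. \<exists>w. step_word T w p = q)"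

definition minimal :: "'s transducer \<Rightarrow> bool" where
  "minimal T \<longleftrightarrow>
     (\<forall>p q. (p, q) \<in> omega_equiv T \<longrightarrow> p = q) \<and>
     (\<forall>q \<in> states T. \<not> incomplete_response T q) \<and>
     strongly_connected T"

definition sync_level :: "'s transducer \<Rightarrow> nat \<Rightarrow> bool" where
  "sync_level T k \<longleftrightarrow>
     (\<forall>w. length w = k \<longrightarrow> (\<forall>p \<in> states T. \<forall>q \<in> states T. step_word T w p = step_word T w q))"

definition strongly_synchronizing :: "'s transducer \<Rightarrow> bool" where
  "strongly_synchronizing T \<longleftrightarrow> (\<exists>k. sync_level T k)"

text \<open>All synchronizing levels give the same set of states, so none has to be chosen here.\<close>

definition core :: "'s transducer \<Rightarrow> 's transducer" where
  "core T = T\<lparr>states := {step_word T w q | w q. sync_level T (length w) \<and> q \<in> states T}\<rparr>"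

definition SO2 :: "'s transducer set" where
  "SO2 = {T. transducer T \<and> minimal T \<and> strongly_synchronizing T \<and> states (core T) = states T \<and>
     (\<forall>t \<in> states T. inj (induced T t) \<and>
        open (range (induced T t)) \<and> closed (range (induced T t)))}"

definition star :: "'s transducer \<Rightarrow> 't transducer \<Rightarrow> ('s \<times> 't) transducer" where
  "star T U =
     \<lparr>states = states T \<times> states U,
      step = (\<lambda>a (p, q). (step T a p, step_word U (out T a p) q)),
      out = (\<lambda>a (p, q). out_word U (out T a p) q)\<rparr>"

definition complete_response :: "'s transducer \<Rightarrow> 's transducer" where
  "complete_response T =
     T\<lparr>out := (\<lambda>a q. drop (length (Lambda T q)) (out T a q @ Lambda T (step T a q)))\<rparr>"

text \<open>
  The transitions and outputs of a class are those of an arbitrary representative; once incomplete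
  response has been removed, they do not depend on it.
\<close>

definition quotient_transducer :: "'s transducer \<Rightarrow> 's set transducer" where
  "quotient_transducer T =
     \<lparr>states = states T // omega_equiv T,
      step = (\<lambda>a C. omega_equiv T `` {step T a (SOME q. q \<in> C)}),
      out = (\<lambda>a C. out T a (SOME q. q \<in> C))\<rparr>"

definition product :: "'s transducer \<Rightarrow> 't transducer \<Rightarrow> ('s \<times> 't) set transducer" where
  "product T U = core (quotient_transducer (complete_response (core (star T U))))"

definition iso :: "'s transducer \<Rightarrow> 't transducer \<Rightarrow> bool" where
  "iso T U \<longleftrightarrow>
     (\<exists>f. bij_betw f (states T) (states U) \<and> (\<forall>q \<in> states T. induced U (f q) = induced T q))"

definition id_transducer :: "unit transducer" where
  "id_transducer = \<lparr>states = UNIV, step = (\<lambda>a q. q), out = (\<lambda>a q. [a])\<rparr>"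

text \<open>
  The units of the monoid. Since transducers are taken up to \<^const>\<open>iso\<close> and have countably many
  states, no generality is lost by letting the inverse have natural numbers as states.
\<close>

definition O2 :: "'s transducer set" where
  "O2 = {T \<in> SO2. \<exists>U :: nat transducer. U \<in> SO2 \<and>
     iso (product T U) id_transducer \<and> iso (product U T) id_transducer}"

definition TO2 :: "'s transducer set" where
  "TO2 = {T \<in> O2.
     (\<forall>t \<in> states T. monotone less_fun less_fun (induced T t)) \<or>
     (\<forall>t \<in> states T. monotone less_fun (\<lambda>x y. less_fun y x) (induced T t))}"

end

theory Submission
  imports Defs "HOL-Library.Omega_Words_Fun"
begin

text \<open>
  Write \<open>h_q\<close> for \<^term>\<open>induced T q\<close>, and \<open>a^\<omega>\<close> for the constant sequence of the letter \<open>a\<close>.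

  Suppose that \<open>T\<close> has more than one state, and let \<open>k + 1\<close> be its least synchronizing level. Some word
  \<open>w\<close> of length \<open>k\<close> leads two states to different states. Each of the two was entered by reading a
  letter, and not by the same letter, because \<open>k + 1\<close> letters synchronize. So \<open>0w\<close> always leads to one
  state \<open>s\<close> and \<open>1w\<close> always leads to another state \<open>s'\<close>. It follows that \<open>s\<close> and \<open>s'\<close> have the same
  successors. It also follows that no state is entered by both letters, since reading \<open>w\<close> from it
  reveals the letter. This is the step that needs an alphabet of two letters.

  The order enters only through adjacent sequences, which are the pairs \<open>z01^\<omega>\<close>, \<open>z10^\<omega>\<close>: these are the
  pairs with nothing strictly between them. Since \<open>T\<close> is invertible and its maps are all monotone
  or all antitone, they carry adjacent sequences to adjacent sequences (\<open>adjacent_induced\<close>).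

  The heart of the proof is \<open>constant_input_not_constant_output\<close>: if \<open>r\<close> is entered by the letter
  other than \<open>a\<close>, then \<open>h_r(a^\<omega>)\<close> is not constant. Suppose that \<open>h_r(a^\<omega>) = b^\<omega>\<close>, and consider the partial
  map \<open>x \<mapsto> h_r\<inverse>(b h_r(x))\<close>, which inserts a letter \<open>b\<close> into the output and fixes \<open>a^\<omega>\<close>. The inverse
  transducer synchronizes, so it forgets the inserted letter after boundedly many further ones.
  Hence, on small cones, the insertion merely exchanges one prefix of the input for another
  (\<open>pulled_back_insertion\<close>). Move away from \<open>a^\<omega>\<close>. On the near side of a gap between adjacent sequences
  the insertion is known, and adjacency carries one value across the gap. On the far side the
  insertion again exchanges prefixes, and the same prefixes as before: any other exchange would
  identify a state entered by \<open>a\<close> with a state entered by the other letter. Thus a single exchange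
  describes the insertion everywhere. It has the form \<open>x \<mapsto> a^j x\<close> with \<open>j > 0\<close>, and then reading \<open>a^j\<close>
  leads \<open>r\<close> back to itself, so that \<open>r\<close> is entered by \<open>a\<close> as well, which is impossible.

  To finish, let \<open>p\<close> and \<open>q\<close> be the outputs of \<open>s\<close> on \<open>0\<close> and \<open>1\<close>. Let \<open>x\<close> be the image of \<open>1^\<omega>\<close> under the
  \<open>0\<close>-successor of \<open>s\<close>, and \<open>y\<close> the image of \<open>0^\<omega>\<close> under its \<open>1\<close>-successor. Neither \<open>x\<close> nor \<open>y\<close> is constant,
  and \<open>px\<close> and \<open>qy\<close> are adjacent. Because the response of \<open>s\<close> is complete, \<open>p\<close> or \<open>q\<close> is empty. These
  conditions determine \<open>p\<close> and \<open>q\<close> (\<open>adjacent_conc_determined\<close>). For \<open>s'\<close> the sequences \<open>x\<close> and \<open>y\<close> are the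
  same, so \<open>s\<close> and \<open>s'\<close> have the same outputs and the same successors. They are therefore
  \<open>\<omega>\<close>-equivalent, which contradicts minimality.
\<close>

section \<open>Infinite words\<close>

declare build_cons [simp del] build_append [simp del]

lemma seq_prefix_eq [simp]: "seq_prefix n x = prefix n x"
  by (simp add: seq_prefix_def subsequence_def)

lemma conc_const [simp]: "replicate n a \<frown> (\<lambda>_. a) = (\<lambda>_. a)"
  by (rule ext) (simp add: conc_def)

lemma conc_cancel:
  fixes f g :: "'a \<Rightarrow> seq"
  assumes "\<And>t. u \<frown> f t = v \<frown> g t" and "length u \<le> length v"
  obtains w where "v = u @ w" "\<And>t. f t = w \<frown> g t"
proof -
  define w where "w = drop (length u) v"
  have "f t = w \<frown> g t" for t
  proof -
    have "suffix (length u) (u \<frown> f t) = suffix (length u) (v \<frown> g t)"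
      by (simp only: assms(1))
    with assms(2) show ?thesis by (simp add: w_def)
  qed
  moreover have "v = u @ w"
  proof -
    have "prefix (length u) (u \<frown> f t) = prefix (length u) (v \<frown> g t)" for t
      by (simp only: assms(1))
    with assms(2) have "u = take (length u) v" by simp
    then show ?thesis unfolding w_def by (metis append_take_drop_id)
  qed
  ultimately show thesis using that by blast
qed

text \<open>
  A prefix shared by all sequences that begin with \<open>v\<close> cannot be longer than \<open>v\<close>, because the letter
  after \<open>v\<close> is arbitrary.
\<close>

lemma prefix_of_all:
  fixes f :: "seq \<Rightarrow> seq"
  assumes eq: "\<And>t. u \<frown> f t = v \<frown> t"
  obtains w where "v = u @ w" "\<And>t. f t = w \<frown> t"
proof -
  have "length u \<le> length v"
  proof (rule ccontr)
    assume lt: "\<not> length u \<le> length v"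
    then have "(u \<frown> f (\<lambda>_. True)) (length v) = (u \<frown> f (\<lambda>_. False)) (length v)"
      by simp
    then have "(v \<frown> (\<lambda>_. True)) (length v) = (v \<frown> (\<lambda>_. False)) (length v)"
      by (simp only: eq)
    then show False by simp
  qed
  then show thesis
    by (rule conc_cancel [where g = "\<lambda>t. t", OF eq]) (rule that)
qed

lemma conc_const_eqD:
  assumes "v \<frown> (\<lambda>_. a) = w \<frown> (\<lambda>_. a)"
  obtains m n where "v @ replicate m a = w @ replicate n a"
proof -
  have "v @ replicate (length w) a = w @ replicate (length v) a"
  proof -
    have "(v @ replicate (length w) a) \<frown> (\<lambda>_. a) = (w @ replicate (length v) a) \<frown> (\<lambda>_. a)"
      using assms by (simp flip: conc_conc)
    then show ?thesis
      by (subst (asm) concat_eq) auto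
  qed
  then show thesis using that by blast
qed

lemma open_contains_cone:
  fixes S :: "seq set"
  assumes "open S" "x \<in> S"
  obtains n where "\<And>y. prefix n x \<frown> y \<in> S"
proof -
  obtain X where X: "x \<in> (\<Pi>\<^sub>E i\<in>UNIV. X i)" "finite {i. X i \<noteq> UNIV}" "(\<Pi>\<^sub>E i\<in>UNIV. X i) \<subseteq> S"
    using product_topology_open_contains_basis [of "\<lambda>_. euclidean" UNIV S x] assms
    unfolding open_fun_def by auto
  obtain n where n: "\<forall>i\<in>{i. X i \<noteq> UNIV}. i < n"
    using X(2) finite_nat_set_iff_bounded by auto
  have "prefix n x \<frown> y \<in> S" for y
  proof -
    have "(prefix n x \<frown> y) i \<in> X i" for i
    proof (cases "i < n")
      case True
      then show ?thesis using X(1) by auto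
    next
      case False
      then show ?thesis using n by (metis UNIV_I mem_Collect_eq)
    qed
    then show ?thesis using X(3) by auto
  qed
  then show thesis using that by blast
qed

section \<open>Adjacent sequences\<close>

text \<open>
  The pairs \<open>z01^\<omega>\<close>, \<open>z10^\<omega>\<close>, in either order; \<open>n\<close> is the length of \<open>z\<close>.
\<close>

definition adjacent :: "seq \<Rightarrow> seq \<Rightarrow> bool" where
  "adjacent x y \<longleftrightarrow> (\<exists>n. (\<forall>i<n. x i = y i) \<and> x n \<noteq> y n \<and> (\<forall>i>n. x i = y n \<and> y i = x n))"

lemma adjacent_sym: "adjacent x y \<Longrightarrow> adjacent y x"
  unfolding adjacent_def by metis

text \<open>
  The position where two adjacent sequences part can be read off either of them: it is the last one
  whose letter differs from the constant tail.
\<close>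

lemma adjacent_unique:
  assumes "adjacent x y" "adjacent x y'"
  shows "y = y'"
proof -
  obtain n where n: "\<forall>i<n. x i = y i" "x n \<noteq> y n" "\<forall>i>n. x i = y n \<and> y i = x n"
    using assms(1) unfolding adjacent_def by blast
  obtain m where m: "\<forall>i<m. x i = y' i" "x m \<noteq> y' m" "\<forall>i>m. x i = y' m \<and> y' i = x m"
    using assms(2) unfolding adjacent_def by blast
  have "m = n"
  proof (rule linorder_cases)
    assume "m < n"
    then have "x n = y' m" "x (Suc n) = y' m" using m(3) by (metis, metis less_SucI)
    moreover have "x (Suc n) = y n" using n(3) by blast
    ultimately show ?thesis using n(2) by metis
  next
    assume "n < m"
    then have "x m = y n" "x (Suc m) = y n" using n(3) by (metis, metis less_SucI)
    moreover have "x (Suc m) = y' m" using m(3) by blast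
    ultimately show ?thesis using m(2) by metis
  qed
  show ?thesis
  proof
    fix i
    consider "i < n" | "i = n" | "n < i" by linarith
    then show "y i = y' i"
    proof cases
      case 1
      then show ?thesis using n(1) m(1) \<open>m = n\<close> by metis
    next
      case 2
      then show ?thesis using n(2) m(2) \<open>m = n\<close> by metis
    next
      case 3
      then show ?thesis using n(3) m(3) \<open>m = n\<close> by metis
    qed
  qed
qed

lemma adjacent_conc [simp]: "adjacent (w \<frown> x) (w \<frown> y) \<longleftrightarrow> adjacent x y"
proof
  assume "adjacent x y"
  then obtain n where n: "\<forall>i<n. x i = y i" "x n \<noteq> y n" "\<forall>i>n. x i = y n \<and> y i = x n"
    unfolding adjacent_def by blast
  show "adjacent (w \<frown> x) (w \<frown> y)"
    unfolding adjacent_def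
    by (rule exI [of _ "length w + n"]) (use n in \<open>auto simp: conc_def\<close>)
next
  assume "adjacent (w \<frown> x) (w \<frown> y)"
  then obtain n where n: "\<forall>i<n. (w \<frown> x) i = (w \<frown> y) i" "(w \<frown> x) n \<noteq> (w \<frown> y) n"
    "\<forall>i>n. (w \<frown> x) i = (w \<frown> y) n \<and> (w \<frown> y) i = (w \<frown> x) n"
    unfolding adjacent_def by blast
  have le: "length w \<le> n"
    using n(2) by (cases "n < length w") auto
  have at: "x i = (w \<frown> x) (length w + i)" "y i = (w \<frown> y) (length w + i)" for i
    by simp_all
  have n_eq: "length w + (n - length w) = n" using le by simp
  show "adjacent x y"
    unfolding adjacent_def
  proof (intro exI [of _ "n - length w"] conjI allI impI)
    fix i assume "i < n - length w"
    then have "length w + i < n" by linarith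
    then show "x i = y i" using n(1) at [of i] by metis
  next
    show "x (n - length w) \<noteq> y (n - length w)"
      using n(2) at [of "n - length w"] unfolding n_eq by metis
  next
    fix i assume "n - length w < i"
    then have "n < length w + i" by linarith
    then show "x i = y (n - length w)" "y i = x (n - length w)"
      using n(3) at [of i] at [of "n - length w"] unfolding n_eq by metis+
  qed
qed

lemma adjacent_middle: "adjacent ([a] \<frown> (\<lambda>_. \<not> a)) ([\<not> a] \<frown> (\<lambda>_. a))"
  unfolding adjacent_def by (rule exI [of _ 0]) simp

definition between :: "seq \<Rightarrow> seq \<Rightarrow> seq \<Rightarrow> bool" where
  "between x z y \<longleftrightarrow> less_fun x z \<and> less_fun z y \<or> less_fun y z \<and> less_fun z x"

lemma less_fun_total: "less_fun x y \<or> x = y \<or> less_fun y x" for x y :: seq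
proof (cases "x = y")
  case False
  then obtain k where "x k \<noteq> y k" by auto
  define m where "m = (LEAST k. x k \<noteq> y k)"
  have "x m \<noteq> y m" using \<open>x k \<noteq> y k\<close> unfolding m_def by (rule LeastI)
  moreover have "\<forall>i<m. x i = y i" unfolding m_def using not_less_Least by blast
  ultimately show ?thesis
    unfolding less_fun_def by (metis linorder_neq_iff)
qed simp

text \<open>
  This makes adjacency an order-theoretic notion that does not change when the order is reversed, so
  that monotone and antitone maps can be treated alike.
\<close>

lemma adjacent_iff: "adjacent x y \<longleftrightarrow> x \<noteq> y \<and> (\<nexists>z. between x z y)"
proof -
  have up: "\<nexists>z. between x z y" if adj: "adjacent x y" and lt: "less_fun x y" for x y :: seq
  proof
    assume "\<exists>z. between x z y"
    then obtain z where z: "less_fun x z" "less_fun z y"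
      unfolding between_def using lt by (metis less_fun_asym less_fun_trans)
    obtain n where n: "\<forall>i<n. x i = y i" "x n \<noteq> y n" "\<forall>i>n. x i = y n \<and> y i = x n"
      using adj unfolding adjacent_def by blast
    obtain j where j: "x j < y j" "\<forall>i<j. x i = y i"
      using lt unfolding less_fun_def by blast
    have "x j \<noteq> y j" using j(1) by simp
    then have "j = n" using j(2) n by (metis linorder_neqE_nat)
    with j have xy: "\<not> x n" "y n" by auto
    obtain k where k: "x k < z k" "\<forall>i<k. x i = z i"
      using z(1) unfolding less_fun_def by blast
    have kn: "k \<le> n" using k(1) n(3) xy by (metis less_bool_def not_le)
    obtain l where l: "z l < y l" "\<forall>i<l. z i = y i"
      using z(2) unfolding less_fun_def by blast
    have ln: "l \<le> n" using l(1) n(3) xy by (metis less_bool_def not_le)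
    show False
    proof (cases k l rule: linorder_cases)
      case less
      then have "x k = y k" "z k = y k" using l(2) n(1) ln by auto
      then show False using k(1) by simp
    next
      case equal
      then show False using k(1) l(1) by auto
    next
      case greater
      then have "x l = y l" "x l = z l" using k(2) n(1) kn by auto
      then show False using l(1) by simp
    qed
  qed
  have down: "adjacent x y" if xy: "less_fun x y" "\<nexists>z. between x z y" for x y :: seq
  proof -
    obtain n where n: "x n < y n" "\<forall>i<n. x i = y i"
      using xy(1) unfolding less_fun_def by blast
    have "x i \<and> \<not> y i" if "n < i" for i
    proof (rule ccontr)
      assume *: "\<not> (x i \<and> \<not> y i)"
      \<comment> \<open>Beyond the first difference, a single flipped letter yields a sequence in between.\<close>
      define z where "z = (if x i then y(i := False) else x(i := True))"
      have "less_fun x z"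
        unfolding less_fun_def
        by (rule exI [of _ "if x i then n else i"]) (use n that in \<open>auto simp: z_def\<close>)
      moreover have "less_fun z y"
        unfolding less_fun_def
        by (rule exI [of _ "if x i then i else n"]) (use n that * in \<open>auto simp: z_def\<close>)
      ultimately show False using xy(2) unfolding between_def by blast
    qed
    then show ?thesis
      unfolding adjacent_def by (intro exI [of _ n]) (use n in auto)
  qed
  have ne: "x \<noteq> y" if "adjacent x y" for x y
    using that unfolding adjacent_def by metis
  have comm: "between x z y \<longleftrightarrow> between y z x" for x y z
    unfolding between_def by blast
  consider "less_fun x y" | "x = y" | "less_fun y x"
    using less_fun_total by blast
  then show ?thesis
  proof cases
    case 1
    then show ?thesis using up [of x y] down [of x y] ne by metis
  next
    case 2
    then show ?thesis using ne by blast
  next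
    case 3
    then show ?thesis using up [of y x] down [of y x] ne comm adjacent_sym by metis
  qed
qed

lemma less_fun_conc: "less_fun x y \<Longrightarrow> less_fun (w \<frown> x) (w \<frown> y)" for x y :: seq
proof -
  assume "less_fun x y"
  then obtain k where k: "x k < y k" "\<forall>i<k. x i = y i"
    unfolding less_fun_def by blast
  show ?thesis
    unfolding less_fun_def
    by (rule exI [of _ "length w + k"]) (use k in \<open>auto simp: conc_def\<close>)
qed

section \<open>Transducers and their induced maps\<close>

lemma step_word_append: "step_word T (v @ w) q = step_word T w (step_word T v q)"
  by (induction v arbitrary: q) simp_all

lemma out_word_append: "out_word T (v @ w) q = out_word T v q @ out_word T w (step_word T v q)"
  by (induction v arbitrary: q) simp_all

lemma step_word_in_states:
  assumes "transducer T" "q \<in> states T"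
  shows "step_word T w q \<in> states T"
  using assms by (induction w arbitrary: q) (auto simp: transducer_def)

lemma out_word_unbounded:
  assumes "transducer T" "q \<in> states T"
  obtains n where "m \<le> length (out_word T (prefix n x) q)"
  using assms unfolding transducer_def seq_prefix_eq by blast

lemma length_out_word_mono:
  assumes "m \<le> n"
  shows "length (out_word T (prefix m x) q) \<le> length (out_word T (prefix n x) q)"
  using subsequence_append [of x m "n - m"] assms by (simp add: out_word_append)

lemma induced_nth:
  assumes "i < length (out_word T (prefix n x) q)"
  shows "induced T q x i = out_word T (prefix n x) q ! i"
proof -
  define m where "m = (LEAST n. i < length (out_word T (prefix n x) q))"
  have m: "i < length (out_word T (prefix m x) q)" "m \<le> n"
    unfolding m_def using assms by (rule LeastI, rule Least_le)
  have "out_word T (prefix m x) q ! i = out_word T (prefix n x) q ! i"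
    using subsequence_append [of x m "n - m"] m by (simp add: out_word_append nth_append)
  then show ?thesis by (simp add: induced_def m_def)
qed

lemma induced_conc:
  assumes "transducer T" "q \<in> states T"
  shows "induced T q (w \<frown> x) = out_word T w q \<frown> induced T (step_word T w q) x"
proof
  fix i
  have q': "step_word T w q \<in> states T"
    using assms by (rule step_word_in_states)
  obtain n where n: "Suc i \<le> length (out_word T (prefix n x) (step_word T w q))"
    using out_word_unbounded [OF assms(1) q'] by blast
  have *: "out_word T (prefix (length w + n) (w \<frown> x)) q =
      out_word T w q @ out_word T (prefix n x) (step_word T w q)"
    by (simp add: out_word_append)
  have "induced T q (w \<frown> x) i = (out_word T w q @ out_word T (prefix n x) (step_word T w q)) ! i"
    by (subst induced_nth [where n = "length w + n"]) (use n * in simp_all)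
  also have "\<dots> = (out_word T w q \<frown> induced T (step_word T w q) x) i"
    using n induced_nth [of "i - length (out_word T w q)" T x n "step_word T w q"]
    by (simp add: nth_append conc_def)
  finally show "induced T q (w \<frown> x) i = (out_word T w q \<frown> induced T (step_word T w q) x) i" .
qed

lemma induced_eqI:
  assumes "transducer T" "q \<in> states T"
    and "\<And>n. \<exists>z. y = out_word T (prefix n x) q \<frown> z"
  shows "induced T q x = y"
proof
  fix i
  obtain n where n: "Suc i \<le> length (out_word T (prefix n x) q)"
    using out_word_unbounded [OF assms(1,2)] by blast
  moreover obtain z where "y = out_word T (prefix n x) q \<frown> z"
    using assms(3) by blast
  ultimately show "induced T q x i = y i"
    by (simp add: induced_nth)
qed

lemma sync_level_Suc:
  fixes T :: "'s transducer"
  assumes step: "\<And>a q. q \<in> states T \<Longrightarrow> step T a q \<in> states T" and "sync_level T k"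
  shows "sync_level T (Suc k)"
  unfolding sync_level_def
proof (intro allI impI ballI)
  fix w :: "bool list" and p q
  assume w: "length w = Suc k" and pq: "p \<in> states T" "q \<in> states T"
  obtain a v where "w = a # v" "length v = k" using w by (cases w) auto
  moreover have "step T a p \<in> states T" "step T a q \<in> states T"
    using step pq by blast+
  ultimately show "step_word T w p = step_word T w q"
    using assms(2) unfolding sync_level_def by (metis step_word.simps(2))
qed

lemma states_core_iff:
  "q \<in> states (core T) \<longleftrightarrow> (\<exists>w p. q = step_word T w p \<and> sync_level T (length w) \<and> p \<in> states T)"
  by (auto simp: core_def)

lemma step_core [simp]: "step (core T) = step T"
  by (simp add: core_def)

lemma step_in_states_core:
  assumes step: "\<And>a q. q \<in> states T \<Longrightarrow> step T a q \<in> states T" and q: "q \<in> states (core T)"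
  shows "step T a q \<in> states (core T)"
proof -
  obtain w p where w: "q = step_word T w p" "sync_level T (length w)" "p \<in> states T"
    using q unfolding states_core_iff by blast
  then have "step T a q = step_word T (w @ [a]) p" "sync_level T (length (w @ [a]))"
    using sync_level_Suc [OF step] by (simp_all add: step_word_snoc)
  then show ?thesis using w(3) unfolding states_core_iff by blast
qed

lemma step_word_core [simp]: "step_word (core T) w q = step_word T w q"
  by (induction w arbitrary: q) (simp_all add: core_def)

lemma out_word_core [simp]: "out_word (core T) w q = out_word T w q"
  by (induction w arbitrary: q) (simp_all add: core_def)

lemma induced_core [simp]: "induced (core T) q = induced T q"
  by (simp add: induced_def fun_eq_iff)

lemma out_word_star: "out_word (star T U) w (p, q) = out_word U (out_word T w p) q"
  by (induction w arbitrary: p q) (simp_all add: star_def out_word_append)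

lemma transducer_star:
  assumes T: "transducer T" and U: "transducer U"
  shows "transducer (star T U)"
  unfolding transducer_def
proof (intro conjI allI ballI)
  show "countable (states (star T U))" "states (star T U) \<noteq> {}"
    using T U by (auto simp: star_def transducer_def)
  show "step (star T U) a q \<in> states (star T U)" if "q \<in> states (star T U)" for a q
    using that T step_word_in_states [OF U] by (auto simp: star_def transducer_def)
  show "\<exists>n. m \<le> length (out_word (star T U) (seq_prefix n x) q)"
    if q: "q \<in> states (star T U)" for q x m
  proof -
    obtain p r where pr: "q = (p, r)" "p \<in> states T" "r \<in> states U"
      using q by (auto simp: star_def)
    obtain k where k: "m \<le> length (out_word U (prefix k (induced T p x)) r)"
      using out_word_unbounded [OF U pr(3)] by blast
    obtain n where n: "k \<le> length (out_word T (prefix n x) p)"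
      using out_word_unbounded [OF T pr(2)] by blast
    let ?o = "out_word T (prefix n x) p"
    have "?o = prefix (length ?o) (induced T p x)"
      by (rule nth_equalityI) (simp_all add: induced_nth)
    then have "length (out_word U (prefix k (induced T p x)) r) \<le> length (out_word U ?o r)"
      using length_out_word_mono [OF n] by metis
    then show ?thesis using k by (auto simp: pr(1) out_word_star intro: le_trans)
  qed
qed

lemma induced_star:
  assumes T: "transducer T" and U: "transducer U" and pq: "p \<in> states T" "q \<in> states U"
  shows "induced (star T U) (p, q) x = induced U q (induced T p x)"
proof (rule induced_eqI)
  show "transducer (star T U)" "(p, q) \<in> states (star T U)"
    using T U pq by (auto intro: transducer_star) (simp add: star_def)
  fix n
  have "induced T p x = out_word T (prefix n x) p \<frown> induced T (step_word T (prefix n x) p) (suffix n x)"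
    using induced_conc [OF T pq(1), of "prefix n x" "suffix n x"] by simp
  then have "induced U q (induced T p x) = out_word U (out_word T (prefix n x) p) q \<frown>
      induced U (step_word U (out_word T (prefix n x) p) q)
        (induced T (step_word T (prefix n x) p) (suffix n x))"
    using induced_conc [OF U pq(2)] by metis
  then show "\<exists>z. induced U q (induced T p x) = out_word (star T U) (prefix n x) (p, q) \<frown> z"
    by (auto simp: out_word_star)
qed

lemma transducer_core:
  assumes "transducer T" "states (core T) \<noteq> {}"
  shows "transducer (core T)"
  unfolding transducer_def
proof (intro conjI allI ballI)
  have sub: "states (core T) \<subseteq> states T"
    using step_word_in_states [OF assms(1)] by (auto simp: core_def)
  then show "countable (states (core T))"
    by (rule countable_subset) (use assms(1) in \<open>simp add: transducer_def\<close>)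
  show "states (core T) \<noteq> {}" by (fact assms(2))
  show "step (core T) a q \<in> states (core T)" if "q \<in> states (core T)" for a q
    using step_in_states_core [OF _ that] assms(1) by (simp add: transducer_def)
  show "\<exists>n. m \<le> length (out_word (core T) (seq_prefix n x) q)" if "q \<in> states (core T)" for q x m
    using that sub out_word_unbounded [OF assms(1), of q m x] by auto
qed

lemma common_prefix_iff: "common_prefix w S \<longleftrightarrow> (\<forall>x\<in>S. \<exists>y. x = w \<frown> y)"
  unfolding common_prefix_def seq_prefix_eq by (metis prefix_conc_length prefix_suffix)

text \<open>
  Injectivity bounds the common prefixes of the image, so that the maximum in the definition of
  \<^const>\<open>Lambda\<close> is attained.
\<close>

lemma Lambda_greatest:
  assumes "inj (induced T q)"
  shows "common_prefix (Lambda T q) (range (induced T q))"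
    and "common_prefix w (range (induced T q)) \<Longrightarrow> length w \<le> length (Lambda T q)"
proof -
  let ?P = "\<lambda>w. common_prefix w (range (induced T q))"
  have "induced T q (\<lambda>_. True) \<noteq> induced T q (\<lambda>_. False)"
    using injD [OF assms] by (metis (full_types))
  then obtain i where i: "induced T q (\<lambda>_. True) i \<noteq> induced T q (\<lambda>_. False) i"
    by blast
  have bound: "length w \<le> i" if "?P w" for w
  proof (rule ccontr)
    assume "\<not> length w \<le> i"
    moreover obtain y z where "induced T q (\<lambda>_. True) = w \<frown> y" "induced T q (\<lambda>_. False) = w \<frown> z"
      using \<open>?P w\<close> unfolding common_prefix_iff by blast
    ultimately show False using i by simp
  qed
  have nil: "?P []" by (simp add: common_prefix_iff)
  show "?P (Lambda T q)"
    unfolding Lambda_def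
    by (rule arg_max_natI [where b = "Suc i"]) (use nil bound in \<open>auto simp: less_Suc_eq_le\<close>)
  show "length w \<le> length (Lambda T q)" if "?P w"
    unfolding Lambda_def
    by (rule arg_max_nat_le [where b = "Suc i"]) (use that bound in \<open>auto simp: less_Suc_eq_le\<close>)
qed

lemma step_word_complete_response [simp]: "step_word (complete_response T) w q = step_word T w q"
  by (induction w arbitrary: q) (simp_all add: complete_response_def)

text \<open>
  Removing incomplete response advances every output by the part of it that is already determined.
  The point is that \<^term>\<open>Lambda T q\<close> is a prefix of what a step outputs together with the new
  determined part. It cannot be longer, because the rest would be common to all outputs of the
  successor.
\<close>

lemma Lambda_out_word_complete_response:
  assumes T: "transducer T" and inj: "\<And>q. q \<in> states T \<Longrightarrow> inj (induced T q)" and q: "q \<in> states T"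
  shows "Lambda T q @ out_word (complete_response T) w q = out_word T w q @ Lambda T (step_word T w q)"
  using q
proof (induction w arbitrary: q)
  case (Cons a w)
  have q': "step T a q \<in> states T" using T Cons.prems by (simp add: transducer_def)
  let ?v = "out T a q @ Lambda T (step T a q)"
  have ind: "induced T q ([a] \<frown> x) = out T a q \<frown> induced T (step T a q) x" for x
    using induced_conc [OF T Cons.prems, of "[a]" x] by simp
  have "\<exists>y. induced T (step T a q) x = Lambda T (step T a q) \<frown> y" for x
    using Lambda_greatest(1) [OF inj [OF q']] unfolding common_prefix_iff by blast
  then obtain f where f: "\<And>x. induced T (step T a q) x = Lambda T (step T a q) \<frown> f x" by metis
  have "\<exists>y. induced T q x = Lambda T q \<frown> y" for x
    using Lambda_greatest(1) [OF inj [OF Cons.prems]] unfolding common_prefix_iff by blast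
  then obtain g where g: "\<And>x. induced T q x = Lambda T q \<frown> g x" by metis
  have eq: "Lambda T q \<frown> g ([a] \<frown> x) = ?v \<frown> f x" for x
    using ind [of x] f [of x] g by simp
  have le: "length (Lambda T q) \<le> length ?v"
  proof (rule ccontr)
    assume "\<not> length (Lambda T q) \<le> length ?v"
    then obtain w where w: "Lambda T q = ?v @ w" "\<And>x. f x = w \<frown> g ([a] \<frown> x)"
      using conc_cancel [of ?v f "Lambda T q" "\<lambda>x. g ([a] \<frown> x)"] eq by (metis linorder_le_cases)
    have "common_prefix (Lambda T (step T a q) @ w) (range (induced T (step T a q)))"
      using w(2) f unfolding common_prefix_iff by auto
    then have "w = []" using Lambda_greatest(2) [OF inj [OF q']] by fastforce
    then show False using w(1) \<open>\<not> length (Lambda T q) \<le> length ?v\<close> by simp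
  qed
  obtain v where v: "?v = Lambda T q @ v"
    using conc_cancel [of "Lambda T q" "\<lambda>x. g ([a] \<frown> x)" ?v f] eq le by metis
  have "out (complete_response T) a q = drop (length (Lambda T q)) ?v"
    by (simp only: complete_response_def) simp
  then have "Lambda T q @ out (complete_response T) a q = ?v"
    unfolding v by simp
  moreover have "step (complete_response T) a q = step T a q"
    by (simp add: complete_response_def)
  ultimately have "Lambda T q @ out_word (complete_response T) (a # w) q =
      out T a q @ Lambda T (step T a q) @ out_word (complete_response T) w (step T a q)"
    by (metis append.assoc out_word.simps(2))
  then show ?case using Cons.IH [OF q'] by simp
qed simp

lemma transducer_complete_response:
  assumes T: "transducer T" and inj: "\<And>q. q \<in> states T \<Longrightarrow> inj (induced T q)"
  shows "transducer (complete_response T)"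
  unfolding transducer_def
proof (intro conjI allI ballI)
  show "countable (states (complete_response T))" "states (complete_response T) \<noteq> {}"
    using T by (auto simp: complete_response_def transducer_def)
  show "step (complete_response T) a q \<in> states (complete_response T)"
    if "q \<in> states (complete_response T)" for a q
    using that T by (auto simp: complete_response_def transducer_def)
  show "\<exists>n. m \<le> length (out_word (complete_response T) (seq_prefix n x) q)"
    if "q \<in> states (complete_response T)" for q x m
  proof -
    have q: "q \<in> states T" using that by (simp add: complete_response_def)
    obtain n where "m + length (Lambda T q) \<le> length (out_word T (prefix n x) q)"
      using out_word_unbounded [OF T q] by blast
    moreover have "length (Lambda T q) + length (out_word (complete_response T) (prefix n x) q) \<ge>
        length (out_word T (prefix n x) q)"
      using Lambda_out_word_complete_response [OF T inj q, of "prefix n x"]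
      by (metis length_append le_add1)
    ultimately show ?thesis by (intro exI [of _ n]) simp
  qed
qed

lemma induced_complete_response:
  assumes T: "transducer T" and inj: "\<And>q. q \<in> states T \<Longrightarrow> inj (induced T q)" and q: "q \<in> states T"
  shows "induced T q x = Lambda T q \<frown> induced (complete_response T) q x"
proof (rule induced_eqI [OF T q])
  fix n
  have q': "q \<in> states (complete_response T)" using q by (simp add: complete_response_def)
  have "induced (complete_response T) q x = out_word (complete_response T) (prefix n x) q \<frown>
      induced (complete_response T) (step_word T (prefix n x) q) (suffix n x)"
    using induced_conc [OF transducer_complete_response [OF T inj] q', of "prefix n x" "suffix n x"]
    by simp
  then show "\<exists>z. Lambda T q \<frown> induced (complete_response T) q x = out_word T (prefix n x) q \<frown> z"
    using Lambda_out_word_complete_response [OF T inj q, of "prefix n x"]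
    by (metis conc_conc append.assoc)
qed

section \<open>Inverse transducers\<close>

lemma induced_id_transducer [simp]: "induced id_transducer q x = x"
proof
  fix i
  have out: "out_word id_transducer w p = w" for w p
    by (induction w) (simp_all add: id_transducer_def)
  show "induced id_transducer q x i = x i"
    using induced_nth [of i id_transducer x "Suc i" q] by (simp add: out nth_append)
qed

text \<open>
  The isomorphism identifies the product with a single class \<open>X\<close> that returns to itself under both
  letters. Its outputs are those of one representative \<open>p\<close>, and every state in \<open>X\<close> has the same completed
  map \<open>g\<close> as \<open>p\<close>. Hence \<open>g\<close> satisfies \<open>g(ax) = o(a) g(x)\<close> with fixed words \<open>o(a)\<close>. By
  injectivity neither of these is empty, so the equations determine \<open>g\<close>, and \<open>g\<close> is the identity.
  Before completion the map of \<open>p\<close> differs from \<open>g\<close> by a fixed prefix \<open>c\<close>.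
\<close>

lemma product_iso_identityD:
  fixes T :: "'s transducer" and U :: "'t transducer"
  assumes T: "transducer T" and U: "transducer U"
    and injT: "\<And>t. t \<in> states T \<Longrightarrow> inj (induced T t)"
    and injU: "\<And>u. u \<in> states U \<Longrightarrow> inj (induced U u)"
    and iso: "iso (product T U) id_transducer"
  obtains t u c where "t \<in> states T" "u \<in> states U"
    "\<And>x. induced U u (induced T t x) = c \<frown> x"
proof -
  define S where "S = core (star T U)"
  define C where "C = complete_response S"
  define Q where "Q = quotient_transducer C"
  have prod: "product T U = core Q"
    by (simp add: product_def Q_def C_def S_def)
  have Q: "states Q = states C // omega_equiv C"
    "step Q a X = omega_equiv C `` {step C a (SOME q. q \<in> X)}"
    "out Q a X = out C a (SOME q. q \<in> X)" for a X
    by (simp_all add: Q_def quotient_transducer_def)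
  have states_C: "states C = states S" by (simp add: C_def complete_response_def)

  obtain f where f: "bij_betw f (states (core Q)) (states id_transducer)"
    "\<And>X. X \<in> states (core Q) \<Longrightarrow> induced id_transducer (f X) = induced (core Q) X"
    using iso unfolding iso_def prod by blast
  have "card (states (core Q)) = 1"
    using bij_betw_same_card [OF f(1)] by (simp add: id_transducer_def)
  then obtain X where X: "states (core Q) = {X}" by (rule card_1_singletonE)
  have ind_X: "induced Q X x = x" for x
    using f(2) [of X] X by (metis induced_core induced_id_transducer insertI1)

  have "states Q \<noteq> {}"
    using X unfolding core_def by auto
  then have "states S \<noteq> {}"
    unfolding Q(1) states_C by (auto simp: quotient_def)
  then have S: "transducer S"
    unfolding S_def by (rule transducer_core [OF transducer_star [OF T U]])
  have sub: "states S \<subseteq> states T \<times> states U"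
  proof
    fix p assume "p \<in> states S"
    then have "p \<in> states (star T U)"
      unfolding S_def states_core_iff using step_word_in_states [OF transducer_star [OF T U]] by blast
    then show "p \<in> states T \<times> states U" by (simp add: star_def)
  qed
  have ind_S: "induced S (t, u) x = induced U u (induced T t x)" if "(t, u) \<in> states S" for t u x
    using that sub unfolding S_def by (auto intro: induced_star [OF T U])
  have inj_S: "inj (induced S p)" if "p \<in> states S" for p
  proof -
    obtain t u where p: "p = (t, u)" by (cases p)
    have "inj (induced U u)" "inj (induced T t)"
      using that sub injT injU unfolding p by auto
    then have "inj (\<lambda>x. induced U u (induced T t x))"
      unfolding inj_on_def by blast
    then show ?thesis using that unfolding p inj_on_def by (simp add: ind_S)
  qed
  have C: "transducer C"
    unfolding C_def by (rule transducer_complete_response [OF S inj_S])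
  have ind_C: "induced S p x = Lambda S p \<frown> induced C p x" if "p \<in> states S" for p x
    unfolding C_def by (rule induced_complete_response [OF S inj_S that])

  have some: "(SOME q. q \<in> Y) \<in> Y" "Y \<subseteq> states C" if Y: "Y \<in> states Q" for Y
  proof -
    obtain q where q: "q \<in> states C" "Y = omega_equiv C `` {q}"
      using Y unfolding Q(1) quotient_def by blast
    then have "q \<in> Y" by (simp add: omega_equiv_def)
    then show "(SOME q. q \<in> Y) \<in> Y" by (rule someI)
    show "Y \<subseteq> states C" using q by (auto simp: omega_equiv_def)
  qed
  have step_C: "step C a q \<in> states C" if "q \<in> states C" for a q
    using C that by (simp add: transducer_def)
  have step_Q: "step Q a Y \<in> states Q" if "Y \<in> states Q" for a Y
    unfolding Q(2) unfolding Q(1) by (rule quotientI) (use step_C some [OF that] in blast)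
  have X_in: "X \<in> states Q"
  proof -
    obtain w Y where "X = step_word Q w Y" "Y \<in> states Q"
      using X states_core_iff [of X Q] by blast
    moreover have "step_word Q w Y \<in> states Q" if "Y \<in> states Q" for w Y
      using that step_Q by (induction w arbitrary: Y) simp_all
    ultimately show ?thesis by simp
  qed
  have step_X: "step Q a X = X" for a
    using step_in_states_core [OF step_Q, of X a] X by simp

  define p where "p = (SOME q. q \<in> X)"
  have p: "p \<in> X" "p \<in> states C"
    using some [OF X_in] unfolding p_def by blast+
  define g where "g = induced C p"
  have same: "induced C q = g" if "q \<in> X" for q
    using that p(1) X_in unfolding Q(1) quotient_def g_def by (auto simp: omega_equiv_def)
  have g_step: "g ([a] \<frown> x) = out Q a X \<frown> g x" for a x
  proof -
    have "step C a p \<in> step Q a X"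
      unfolding Q(2) p_def [symmetric] using step_C [OF p(2)] by (simp add: omega_equiv_def)
    then have "induced C (step C a p) = g"
      unfolding step_X by (rule same)
    then show ?thesis
      using induced_conc [OF C p(2), of "[a]" x] unfolding g_def Q(3) p_def [symmetric] by simp
  qed
  have g_word: "g (w \<frown> x) = out_word Q w X \<frown> g x" for w x
  proof (induction w)
    case (Cons a w)
    have "g ((a # w) \<frown> x) = g ([a] \<frown> w \<frown> x)" by simp
    also have "\<dots> = out Q a X \<frown> g (w \<frown> x)" by (rule g_step)
    finally show ?case using Cons.IH by (simp add: step_X)
  qed simp
  have p_S: "p \<in> states S" using p(2) states_C by simp
  have inj_g: "inj g"
    using inj_S [OF p_S] ind_C [OF p_S] unfolding g_def inj_on_def by simp
  have out_X: "out Q a X \<noteq> []" for a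
  proof
    assume "out Q a X = []"
    then have "g ([a] \<frown> (\<lambda>_. \<not> a)) = g (\<lambda>_. \<not> a)" by (simp add: g_step)
    then have "([a] \<frown> (\<lambda>_. \<not> a)) 0 = (\<not> a)" using injD [OF inj_g] by metis
    then show False by simp
  qed
  have long: "length w \<le> length (out_word Q w X)" for w
  proof (induction w)
    case (Cons a w)
    then show ?case using out_X [of a] by (cases "out Q a X") (simp_all add: step_X)
  qed simp
  have "g x = x" for x
  proof
    fix i
    have i: "i < length (out_word Q (prefix (Suc i) x) X)"
      using long [of "prefix (Suc i) x"] by simp
    have "g x = out_word Q (prefix (Suc i) x) X \<frown> g (suffix (Suc i) x)"
      using g_word [of "prefix (Suc i) x" "suffix (Suc i) x"] by (simp only: prefix_suffix [symmetric])
    then have "g x i = out_word Q (prefix (Suc i) x) X ! i"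
      using i by simp
    also have "\<dots> = induced Q X x i"
      by (rule induced_nth [OF i, symmetric])
    finally show "g x i = x i" by (simp add: ind_X)
  qed
  then have "induced S p x = Lambda S p \<frown> x" for x
    using ind_C [OF p_S] unfolding g_def by simp
  then show thesis
    using that [of "fst p" "snd p" "Lambda S p"] p_S sub ind_S [of "fst p" "snd p"] by auto
qed

lemma inverse_at_successor:
  assumes T: "transducer T" and U: "transducer U" and "t \<in> states T" "u \<in> states U"
    and inv: "\<And>x. induced U u (induced T t x) = c \<frown> x"
  obtains c' where
    "\<And>x. induced U (step_word U (out_word T w t) u) (induced T (step_word T w t) x) = c' \<frown> x"
proof -
  have *: "out_word U (out_word T w t) u \<frown>
      induced U (step_word U (out_word T w t) u) (induced T (step_word T w t) x) = (c @ w) \<frown> x" for x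
    using inv [of "w \<frown> x"] by (simp add: induced_conc [OF T assms(3)] induced_conc [OF U assms(4)])
  show thesis
    by (rule prefix_of_all [OF *]) (rule that)
qed

section \<open>Minimal synchronizing transducers\<close>

lemma SO2_D:
  assumes "T \<in> SO2"
  shows "transducer T" "strongly_connected T" "\<And>t. t \<in> states T \<Longrightarrow> inj (induced T t)"
    "\<And>t. t \<in> states T \<Longrightarrow> open (range (induced T t))"
    "states (core T) = states T"
    "\<exists>k. sync_level T k"
  using assms by (auto simp: SO2_def minimal_def strongly_synchronizing_def)

lemma SO2_no_common_prefix:
  assumes "T \<in> SO2" "q \<in> states T" and "\<And>x. induced T q x = w \<frown> f x"
  shows "w = []"
proof (rule ccontr)
  assume "w \<noteq> []"
  then have "incomplete_response T q"
    using assms(3) unfolding incomplete_response_def common_prefix_iff by blast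
  then show False using assms(1,2) by (simp add: SO2_def minimal_def)
qed

text \<open>
  The longer of the prefixes exceeds the other by a word common to all values of a map. Complete
  response makes this word empty, and minimality turns equal maps into equal states.
\<close>

lemma SO2_state_eqI:
  assumes T: "T \<in> SO2" and pq: "p \<in> states T" "q \<in> states T"
    and eq: "\<And>x. u \<frown> induced T p x = v \<frown> induced T q x"
  shows "u = v \<and> p = q"
proof -
  have *: "u = v" if pq: "p \<in> states T" and eq: "\<And>x. u \<frown> induced T p x = v \<frown> induced T q x"
    and le: "length u \<le> length v" for p q u v
  proof -
    obtain w where w: "v = u @ w" "\<And>x. induced T p x = w \<frown> induced T q x"
      by (rule conc_cancel [where f = "induced T p" and g = "induced T q", OF eq le]) (rule that)
    have "w = []" by (rule SO2_no_common_prefix [OF T pq w(2)])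
    with w(1) show ?thesis by simp
  qed
  have uv: "u = v"
  proof (cases "length u \<le> length v")
    case True
    then show ?thesis by (rule * [OF pq(1) eq])
  next
    case False
    then have "length v \<le> length u" by simp
    then have "v = u" by (rule * [OF pq(2) eq [symmetric]])
    then show ?thesis by simp
  qed
  have "induced T p = induced T q" using eq unfolding uv same_concat_eq by (rule ext)
  then have "(p, q) \<in> omega_equiv T" using pq by (simp add: omega_equiv_def)
  then show ?thesis using T uv by (simp add: SO2_def minimal_def)
qed

text \<open>
  Reading \<open>w\<close> separates states, but any further letter in front of it or behind it synchronizes. A
  letter behind \<open>w\<close> gives the equal successors; a letter in front of \<open>w\<close> decides which of the two
  states is reached, so the letter that entered a state can be recovered.
\<close>

lemma SO2_distinct_states_with_same_successors:
  assumes T: "T \<in> SO2" and card: "card (states T) \<noteq> 1"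
  obtains s s' where "s \<in> states T" "s' \<in> states T" "s \<noteq> s'" "\<And>a. step T a s = step T a s'"
    "\<And>p q. p \<in> states T \<Longrightarrow> q \<in> states T \<Longrightarrow> step T True p \<noteq> step T False q"
proof -
  have trT: "transducer T" and core: "states (core T) = states T"
    using SO2_D [OF T] by blast+
  have in_states: "step T a p \<in> states T" if "p \<in> states T" for a p
    using that trT by (simp add: transducer_def)
  define K where "K = (LEAST k. sync_level T k)"
  have K: "sync_level T K"
    unfolding K_def using SO2_D(6) [OF T] by (metis LeastI)
  have not0: "\<not> sync_level T 0"
  proof
    assume "sync_level T 0"
    then have "p = q" if "p \<in> states T" "q \<in> states T" for p q
      using that by (simp add: sync_level_def)
    moreover have "states T \<noteq> {}" using trT by (simp add: transducer_def)
    ultimately have "\<exists>q. states T = {q}" by blast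
    then show False using card by auto
  qed
  then obtain k where k: "K = Suc k"
    using K by (cases K) auto
  have "\<not> sync_level T k"
    using not_less_Least [of k "sync_level T"] by (simp add: K_def [symmetric] k)
  then obtain w p q where w: "length w = k" "p \<in> states T" "q \<in> states T"
    "step_word T w p \<noteq> step_word T w q"
    unfolding sync_level_def by blast
  have sync: "step_word T v p = step_word T v q"
    if "length v = Suc k" "p \<in> states T" "q \<in> states T" for v p q
    using K that unfolding k sync_level_def by blast
  have entered: "\<exists>a p'. p' \<in> states T \<and> p = step T a p'" if p: "p \<in> states T" for p
  proof -
    obtain v p0 where v: "p = step_word T v p0" "sync_level T (length v)" "p0 \<in> states T"
      using p states_core_iff [of p T] core by blast
    then obtain v' a where "v = v' @ [a]"
      using not0 by (cases v rule: rev_cases) auto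
    then have "p = step T a (step_word T v' p0)" using v(1) by (simp add: step_word_snoc)
    then show ?thesis using step_word_in_states [OF trT v(3)] by blast
  qed
  obtain a p' where p': "p' \<in> states T" "p = step T a p'" using entered [OF w(2)] by blast
  obtain b q' where q': "q' \<in> states T" "q = step T b q'" using entered [OF w(3)] by blast
  have via_a: "step_word T w (step T a x) = step_word T w p" if "x \<in> states T" for x
    using sync [of "a # w" x p'] that p' w(1) by simp
  have via_b: "step_word T w (step T b x) = step_word T w q" if "x \<in> states T" for x
    using sync [of "b # w" x q'] that q' w(1) by simp
  have "a \<noteq> b"
  proof
    assume ab: "a = b"
    show False using via_a [OF q'(1)] w(4) unfolding q'(2) ab by simp
  qed
  show thesis
  proof (rule that [of "step_word T w p" "step_word T w q"])
    show "step_word T w p \<in> states T" "step_word T w q \<in> states T"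
      using w step_word_in_states [OF trT] by blast+
    show "step_word T w p \<noteq> step_word T w q" by (fact w(4))
    show "step T c (step_word T w p) = step T c (step_word T w q)" for c
      using sync [of "w @ [c]" p q] w by (simp add: step_word_snoc)
    fix x y assume "x \<in> states T" "y \<in> states T"
    then show "step T True x \<noteq> step T False y"
      using via_a [of x] via_a [of y] via_b [of x] via_b [of y] \<open>a \<noteq> b\<close> w(4)
      by (cases a; cases b) auto
  qed
qed

section \<open>Adjacent sequences are preserved\<close>

lemma between_reflect:
  fixes f :: "seq \<Rightarrow> seq"
  assumes "monotone less_fun less_fun f \<or> monotone less_fun (\<lambda>x y. less_fun y x) f"
    and "between (f x) (f z) (f y)"
  shows "between x z y"
  using assms(1)
proof
  assume "monotone less_fun less_fun f"
  then have "less_fun x y" if "less_fun (f x) (f y)" for x y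
    using that less_fun_total [of x y] unfolding monotone_def
    by (metis less_fun_asym less_fun_irrefl)
  then show ?thesis using assms(2) unfolding between_def by blast
next
  assume "monotone less_fun (\<lambda>x y. less_fun y x) f"
  then have "less_fun y x" if "less_fun (f x) (f y)" for x y
    using that less_fun_total [of x y] unfolding monotone_def
    by (metis less_fun_asym less_fun_irrefl)
  then show ?thesis using assms(2) unfolding between_def by blast
qed

text \<open>
  Suppose that \<open>h_t\<close> inverts \<open>h_u\<close> up to the prefix \<open>c\<close>. The image of \<open>h_u\<close> contains a cone, and every state
  \<open>s\<close> is reached from \<open>t\<close> by a word \<open>w\<close> whose cone lies inside that image. So \<open>wx\<close> and \<open>wy\<close> have
  preimages \<open>x'\<close> and \<open>y'\<close> under \<open>h_u\<close>. A sequence \<open>z\<close> between \<open>x'\<close> and \<open>y'\<close> would make \<open>h_u(z)\<close> a sequence between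
  \<open>wx\<close> and \<open>wy\<close>. Hence \<open>x'\<close> and \<open>y'\<close> are adjacent, and so are \<open>h_t(wx) = cx'\<close> and \<open>h_t(wy) = cy'\<close>.
\<close>

lemma adjacent_induced:
  assumes T: "transducer T" "strongly_connected T" and U: "transducer U"
    and t: "t \<in> states T" and u: "u \<in> states U" and s: "s \<in> states T"
    and inv: "\<And>x. induced T t (induced U u x) = c \<frown> x"
    and op: "open (range (induced U u))"
    and mono: "monotone less_fun less_fun (induced T t) \<or>
      monotone less_fun (\<lambda>x y. less_fun y x) (induced T t)"
    and xy: "adjacent x y"
  shows "adjacent (induced T s x) (induced T s y)"
proof -
  obtain n where n: "\<And>y. prefix n (induced U u x) \<frown> y \<in> range (induced U u)"
    using open_contains_cone [OF op rangeI] by blast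
  define e where "e = prefix n (induced U u x)"
  obtain v where v: "step_word T v (step_word T e t) = s"
    using T t s step_word_in_states unfolding strongly_connected_def by metis
  define w where "w = e @ v"
  have ind: "induced T t (w \<frown> z) = out_word T w t \<frown> induced T s z" for z
    using induced_conc [OF T(1) t, of w z] v by (simp add: w_def step_word_append)
  obtain x' y' where x': "w \<frown> x = induced U u x'" and y': "w \<frown> y = induced U u y'"
    using n unfolding w_def e_def by (metis conc_conc imageE)
  have "adjacent x' y'"
    unfolding adjacent_iff
  proof (intro conjI notI)
    assume "x' = y'"
    then have "w \<frown> x = w \<frown> y" using x' y' by simp
    then show False using xy unfolding adjacent_iff by simp
  next
    assume "\<exists>z. between x' z y'"
    then obtain z where "between x' z y'" ..
    then have "between (c \<frown> x') (c \<frown> z) (c \<frown> y')"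
      unfolding between_def by (blast intro: less_fun_conc)
    then have "between (induced T t (w \<frown> x)) (induced T t (induced U u z)) (induced T t (w \<frown> y))"
      unfolding x' y' inv .
    then have "between (w \<frown> x) (induced U u z) (w \<frown> y)"
      by (rule between_reflect [OF mono])
    moreover have "adjacent (w \<frown> x) (w \<frown> y)" using xy by simp
    ultimately show False unfolding adjacent_iff by blast
  qed
  then have "adjacent (induced T t (w \<frown> x)) (induced T t (w \<frown> y))"
    unfolding x' y' inv by simp
  then show ?thesis unfolding ind by simp
qed

section \<open>Inserting a letter into the output\<close>

text \<open>
  An endless chain of extensions would converge to an infinite input with a finite output.
\<close>

lemma wf_extension_short_output:
  assumes T: "transducer T" and q: "q \<in> states T"
  shows "wf {(P @ v, P) | P v. v \<noteq> [] \<and> length (out_word T P q) < K}"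
  unfolding wf_iff_no_infinite_down_chain
proof
  assume "\<exists>f. \<forall>i. (f (Suc i), f i) \<in> {(P @ v, P) | P v. v \<noteq> [] \<and> length (out_word T P q) < K}"
  then obtain f where f: "\<And>i. \<exists>v. v \<noteq> [] \<and> f (Suc i) = f i @ v \<and> length (out_word T (f i) q) < K"
    by blast
  have len: "i \<le> length (f i)" for i
  proof (induction i)
    case (Suc i)
    then show ?case using f [of i] by (auto simp: Suc_le_eq length_greater_0_conv intro: le_less_trans)
  qed simp
  have ext: "\<exists>v. f j = f i @ v" if "i \<le> j" for i j
    using that
  proof (induction rule: dec_induct)
    case (step j)
    then show ?case using f [of j] by auto
  qed simp
  define x where "x i = f (Suc i) ! i" for i
  have "prefix n x = take n (f n)" for n
  proof (rule nth_equalityI)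
    show "length (prefix n x) = length (take n (f n))" using len [of n] by simp
    fix i assume "i < length (prefix n x)"
    then have "i < n" by simp
    then obtain v where "f n = f (Suc i) @ v" using ext [of "Suc i" n] by auto
    then show "prefix n x ! i = take n (f n) ! i"
      using \<open>i < n\<close> len [of "Suc i"] by (simp add: x_def nth_append)
  qed
  then have "f n = prefix n x @ drop n (f n)" for n by simp
  then have "length (out_word T (prefix n x) q) < K" for n
    using f [of n] by (metis add_lessD1 length_append out_word_append)
  then show False
    using out_word_unbounded [OF T q, of K x] by (metis not_le)
qed

text \<open>
  A state \<open>r\<close> of \<open>T\<close> together with a state \<open>u\<close> of a synchronizing transducer that inverts \<open>h_r\<close> up to a
  fixed prefix.
\<close>

locale left_inverse_state =
  fixes T :: "'s transducer" and U :: "'t transducer" and r :: 's and u :: 't and c and K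
  assumes T: "T \<in> SO2" and r: "r \<in> states T"
    and U: "transducer U" and u: "u \<in> states U" and inj_U: "inj (induced U u)"
    and sync: "sync_level U K"
    and inverse: "\<And>x. induced U u (induced T r x) = c \<frown> x"
begin

abbreviation h :: "seq \<Rightarrow> seq" where "h \<equiv> induced T r"

lemma trT: "transducer T" using T by (rule SO2_D)

text \<open>
  After \<open>K\<close> letters of output of \<open>T\<close> the state of \<open>U\<close> no longer depends on whether \<open>b\<close> was read first. From
  then on \<open>U\<close> produces the same sequence in both cases, and without \<open>b\<close> that sequence is a tail of
  \<open>cPt\<close> that contains \<open>t\<close>.
\<close>

lemma pulled_back_insertion:
  assumes "K \<le> length (out_word T P r)"
  obtains v where "\<And>t. induced U u ([b] \<frown> h (P \<frown> t)) = v \<frown> t"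
proof -
  let ?y = "out_word T P r"
  define g where "g = induced U (step_word U ?y u)"
  define k where "k t = induced T (step_word T P r) t" for t
  have h: "h (P \<frown> t) = ?y \<frown> k t" for t
    unfolding k_def by (rule induced_conc [OF trT r])
  have "step_word U (b # ?y) u = step_word U ?y u"
  proof -
    obtain y1 y2 where y: "?y = y1 @ y2" "length y1 = K"
      using assms by (metis append_take_drop_id length_take min_absorb2)
    have "step U b u \<in> states U" using U u by (simp add: transducer_def)
    then have "step_word U y1 (step U b u) = step_word U y1 u"
      using sync u y(2) unfolding sync_level_def by blast
    then show ?thesis by (simp add: y(1) step_word_append)
  qed
  then have bg: "induced U u ([b] \<frown> h (P \<frown> t)) = out_word U (b # ?y) u \<frown> g (k t)" for t
    using induced_conc [OF U u, of "b # ?y" "k t"] by (simp add: h g_def)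
  have "out_word U ?y u \<frown> g (k t) = (c @ P) \<frown> t" for t
    using induced_conc [OF U u, of ?y "k t"] inverse [of "P \<frown> t"] by (simp add: h g_def)
  then obtain w where "\<And>t. g (k t) = w \<frown> t"
    by (rule prefix_of_all) (rule that)
  then show thesis
    using that [of "out_word U (b # ?y) u @ w"] bg by simp
qed

text \<open>
  Both sides begin with a long run of \<open>a\<close>, whose length need not be the same. Injectivity of \<open>h_u\<close>
  reduces the claim to an equation between images under \<open>h_u\<close>, where both sides are known; in
  particular it shows that the right-hand side is a value of \<open>h_r\<close>.
\<close>

lemma insertion_near_tail:
  assumes eq: "h (Q' \<frown> (\<lambda>_. a)) = [b] \<frown> h (Q \<frown> (\<lambda>_. a))"
  obtains m n where "\<And>t. h (Q' \<frown> replicate m a \<frown> t) = [b] \<frown> h (Q \<frown> replicate n a \<frown> t)"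
proof -
  let ?a = "\<lambda>_::nat. a"
  obtain n where n: "K \<le> length (out_word T (prefix n (Q \<frown> ?a)) r)"
    using out_word_unbounded [OF trT r] by blast
  define P where "P = Q @ replicate n a"
  have "prefix (length P) (Q \<frown> ?a) = P"
    unfolding P_def by (rule nth_equalityI) (auto simp: nth_append conc_def)
  moreover have "n \<le> length P" by (simp add: P_def)
  ultimately have "K \<le> length (out_word T P r)"
    using n length_out_word_mono [of n "length P" T "Q \<frown> ?a" r] by simp
  then obtain v where v: "\<And>t. induced U u ([b] \<frown> h (P \<frown> t)) = v \<frown> t"
    by (rule pulled_back_insertion) (rule that)
  have "P \<frown> ?a = Q \<frown> ?a" unfolding P_def by (simp flip: conc_conc)
  then have "v \<frown> ?a = (c @ Q') \<frown> ?a"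
    using v [of ?a] eq inverse [of "Q' \<frown> ?a"] by simp
  then obtain i j where ij: "v @ replicate i a = (c @ Q') @ replicate j a"
    by (rule conc_const_eqD)
  have "h (Q' \<frown> replicate j a \<frown> t) = [b] \<frown> h (Q \<frown> replicate (n + i) a \<frown> t)" for t
  proof -
    have "induced U u ([b] \<frown> h (Q \<frown> replicate (n + i) a \<frown> t)) = (v @ replicate i a) \<frown> t"
      using v [of "replicate i a \<frown> t"] by (simp add: P_def replicate_add)
    also have "\<dots> = induced U u (h (Q' \<frown> replicate j a \<frown> t))"
      using inverse [of "Q' \<frown> replicate j a \<frown> t"] by (simp add: ij)
    finally show ?thesis using injD [OF inj_U] by metis
  qed
  then show thesis by (rule that)
qed

lemma same_state:
  assumes "\<And>t. h (Q' \<frown> t) = [b] \<frown> h (Q \<frown> t)"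
  shows "step_word T Q' r = step_word T Q r" and "out_word T Q' r = b # out_word T Q r"
proof -
  have "out_word T Q' r \<frown> induced T (step_word T Q' r) t =
      (b # out_word T Q r) \<frown> induced T (step_word T Q r) t" for t
    using assms [of t] by (simp add: induced_conc [OF trT r])
  then have "out_word T Q' r = b # out_word T Q r \<and> step_word T Q' r = step_word T Q r"
    by (rule SO2_state_eqI [OF T step_word_in_states [OF trT r] step_word_in_states [OF trT r]])
  then show "step_word T Q' r = step_word T Q r" "out_word T Q' r = b # out_word T Q r" by auto
qed

text \<open>
  Whatever prefix \<open>P'\<close> replaces \<open>P\<close> when \<open>b\<close> is inserted near the end \<open>Pa^\<omega>\<close> of the cone of \<open>P\<close>, it does so on
  the whole cone.
\<close>

definition tail_determines where
  "tail_determines a b P \<longleftrightarrow> (\<forall>P' n. (\<forall>t. h (P' \<frown> replicate n a \<frown> t) = [b] \<frown> h (P \<frown> replicate n a \<frown> t))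
     \<longrightarrow> (\<forall>t. h (P' \<frown> t) = [b] \<frown> h (P \<frown> t)))"

lemma tail_determinesD:
  assumes "tail_determines a b P" "\<And>t. h (P' \<frown> replicate n a \<frown> t) = [b] \<frown> h (P \<frown> replicate n a \<frown> t)"
  shows "h (P' \<frown> t) = [b] \<frown> h (P \<frown> t)"
  using assms unfolding tail_determines_def by blast

lemma tail_determines_if_long_output:
  assumes "K \<le> length (out_word T P r)"
  shows "tail_determines a b P"
  unfolding tail_determines_def
proof (intro allI impI)
  fix P' n t
  assume *: "\<forall>t. h (P' \<frown> replicate n a \<frown> t) = [b] \<frown> h (P \<frown> replicate n a \<frown> t)"
  obtain v where v: "\<And>t. induced U u ([b] \<frown> h (P \<frown> t)) = v \<frown> t"
    using pulled_back_insertion [OF assms] by blast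
  have "(v @ replicate n a) \<frown> t = (c @ P' @ replicate n a) \<frown> t" for t
    using v [of "replicate n a \<frown> t"] * inverse [of "P' \<frown> replicate n a \<frown> t"] by simp
  then obtain w where "c @ P' @ replicate n a = (v @ replicate n a) @ w" "\<And>t. t = w \<frown> t"
    using prefix_of_all [of "v @ replicate n a" "\<lambda>t. t" "c @ P' @ replicate n a"] by blast
  moreover have "w = []"
  proof (rule ccontr)
    assume "w \<noteq> []"
    then have "(\<lambda>_. \<not> w ! 0) 0 = (w \<frown> (\<lambda>_. \<not> w ! 0)) (0::nat)"
      using calculation(2) by metis
    then show False using \<open>w \<noteq> []\<close> by simp
  qed
  ultimately have "v = c @ P'" by simp
  then have "induced U u (h (P' \<frown> t)) = induced U u ([b] \<frown> h (P \<frown> t))"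
    using v inverse by simp
  then show "h (P' \<frown> t) = [b] \<frown> h (P \<frown> t)" by (rule injD [OF inj_U])
qed

text \<open>
  The runs of \<open>a\<close> that match near the tails may differ in length. If they agree, the insertion
  extends to the cones of \<open>Q\<close> and \<open>Q'\<close>. Otherwise it extends to cones that are shifted against each
  other by a run of \<open>a\<close>, and equal maps come from equal states.
\<close>

lemma insertion_or_coincidence:
  assumes eq: "h (Q' \<frown> (\<lambda>_. a)) = [b] \<frown> h (Q \<frown> (\<lambda>_. a))"
    and good: "\<And>j. tail_determines a b (Q @ replicate j a)"
  obtains (insertion) "\<And>t. h (Q' \<frown> t) = [b] \<frown> h (Q \<frown> t)"
  | (later) j where "step_word T (Q' @ replicate (Suc j) a) r = step_word T Q r"
  | (earlier) j where "step_word T Q' r = step_word T (Q @ replicate (Suc j) a) r"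
proof -
  obtain m n where mn: "\<And>t. h (Q' \<frown> replicate m a \<frown> t) = [b] \<frown> h (Q \<frown> replicate n a \<frown> t)"
    using insertion_near_tail [OF eq] by blast
  consider "m = n" | j where "m = Suc j + n" | j where "n = Suc j + m"
    by (metis add.commute add_Suc less_iff_Suc_add linorder_neqE_nat)
  then show thesis
  proof cases
    case 1
    then show thesis using tail_determinesD [of a b Q Q' m] good [of 0] mn insertion by simp
  next
    case 2
    have "h ((Q' @ replicate (Suc j) a) \<frown> t) = [b] \<frown> h (Q \<frown> t)" for t
      by (rule tail_determinesD [of a b _ _ n]) (use good [of 0] mn in \<open>simp_all add: 2 replicate_add\<close>)
    then show thesis using same_state(1) later by blast
  next
    case 3
    have "h (Q' \<frown> t) = [b] \<frown> h ((Q @ replicate (Suc j) a) \<frown> t)" for t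
      by (rule tail_determinesD [of a b _ _ m]) (use good [of "Suc j"] mn in \<open>simp_all add: 3 replicate_add\<close>)
    then show thesis using same_state(1) earlier by blast
  qed
qed

text \<open>
  The induction runs over the cones of \<open>P\<close>, ending with those whose output is so long that
  \<open>pulled_back_insertion\<close> applies. The half of the cone that contains \<open>Pa^\<omega>\<close> is handled by the
  induction hypothesis. Adjacency across the middle of the cone then supplies the insertion at one
  point of the other half. The state comparisons that \<open>insertion_or_coincidence\<close> leaves open
  all equate a state entered by \<open>a\<close> with one entered by the other letter.
\<close>

lemma constant_input_not_constant_output:
  assumes disj: "\<And>p q. p \<in> states T \<Longrightarrow> q \<in> states T \<Longrightarrow> step T True p \<noteq> step T False q"
    and adj: "\<And>s a. s \<in> states T \<Longrightarrow>
      adjacent (induced T s ([a] \<frown> (\<lambda>_. \<not> a))) (induced T s ([\<not> a] \<frown> (\<lambda>_. a)))"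
    and entry: "p \<in> states T" "step T (\<not> a) p = r"
  shows "h (\<lambda>_. a) \<noteq> (\<lambda>_. b)"
proof
  assume tail: "h (\<lambda>_. a) = (\<lambda>_. b)"
  let ?a = "\<lambda>_::nat. a"
  have apart: "step T a p \<noteq> step T (\<not> a) q" if "p \<in> states T" "q \<in> states T" for p q
    using disj [OF that] disj [OF that(2,1)] by (cases a) auto
  have in_states: "step_word T w r \<in> states T" for w
    by (rule step_word_in_states [OF trT r])
  have "tail_determines a b P" for P
    using wf_extension_short_output [OF trT r, of K]
  proof (induction P rule: wf_induct_rule)
    case (less P)
    show ?case
    proof (cases "K \<le> length (out_word T P r)")
      case True
      then show ?thesis by (rule tail_determines_if_long_output)
    next
      case False
      then have IH: "tail_determines a b (P @ v)" if "v \<noteq> []" for v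
        using less that by auto
      show ?thesis
        unfolding tail_determines_def
      proof (rule allI, rule allI, rule impI)
        fix P' n
        assume *: "\<forall>t. h (P' \<frown> replicate n a \<frown> t) = [b] \<frown> h (P \<frown> replicate n a \<frown> t)"
        show "\<forall>t. h (P' \<frown> t) = [b] \<frown> h (P \<frown> t)"
        proof (cases n)
          case 0
          then show ?thesis using * by simp
        next
          case (Suc k)
          have near: "h ((P' @ [a]) \<frown> t) = [b] \<frown> h ((P @ [a]) \<frown> t)" for t
            by (rule tail_determinesD [OF IH, of "[a]" _ k]) (use * Suc in simp_all)
          have adj': "adjacent (h ((Q @ [a]) \<frown> (\<lambda>_. \<not> a))) (h ((Q @ [\<not> a]) \<frown> ?a))" for Q
            using adj [OF in_states [of Q], of a]
            by (simp add: induced_conc [OF trT r, of Q] flip: conc_conc)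
          have "adjacent (h ((P' @ [a]) \<frown> (\<lambda>_. \<not> a))) ([b] \<frown> h ((P @ [\<not> a]) \<frown> ?a))"
            unfolding near adjacent_conc by (rule adj')
          then have "h ((P' @ [\<not> a]) \<frown> ?a) = [b] \<frown> h ((P @ [\<not> a]) \<frown> ?a)"
            using adj' adjacent_unique by blast
          then have far: "h ((P' @ [\<not> a]) \<frown> t) = [b] \<frown> h ((P @ [\<not> a]) \<frown> t)" for t
          proof (rule insertion_or_coincidence)
            show "tail_determines a b ((P @ [\<not> a]) @ replicate j a)" for j
              using IH [of "[\<not> a] @ replicate j a"] by simp
          next
            fix j assume "step_word T ((P' @ [\<not> a]) @ replicate (Suc j) a) r = step_word T (P @ [\<not> a]) r"
            then have False
              using apart [OF in_states in_states] unfolding replicate_append_same [symmetric]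
              by (metis append_assoc replicate_Suc replicate_append_same step_word_snoc)
            then show ?thesis ..
          next
            fix j assume "step_word T (P' @ [\<not> a]) r = step_word T ((P @ [\<not> a]) @ replicate (Suc j) a) r"
            then have False
              using apart [OF in_states in_states]
              by (metis append_assoc replicate_Suc replicate_append_same step_word_snoc)
            then show ?thesis ..
          qed blast
          show ?thesis
          proof
            fix t :: seq
            have "t = [t 0] \<frown> suffix 1 t"
              using prefix_suffix [of t 1] by simp
            then obtain t' where "t = [a] \<frown> t' \<or> t = [\<not> a] \<frown> t'" by (cases a; cases "t 0") auto
            then show "h (P' \<frown> t) = [b] \<frown> h (P \<frown> t)"
              using near [of t'] far [of t'] by auto
          qed
        qed
      qed
    qed
  qed
  note determined = this
  have r_loop: "step_word T (replicate (Suc j) a) r \<noteq> r" for j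
    using apart [OF in_states entry(1)] entry(2)
    by (metis replicate_Suc replicate_append_same step_word_snoc)
  have "h ([] \<frown> ?a) = [b] \<frown> h ([] \<frown> ?a)"
    by (rule ext) (simp add: tail conc_def)
  then show False
  proof (rule insertion_or_coincidence)
    assume "\<And>t. h ([] \<frown> t) = [b] \<frown> h ([] \<frown> t)"
    then show False using same_state(2) [of "[]" b "[]"] by simp
  qed (use determined r_loop in \<open>auto dest: sym\<close>)
qed

end

section \<open>A single state\<close>

text \<open>
  If the sequences parted within \<open>p\<close>, then \<open>x\<close> would lie beyond the last change of letter and be
  constant; likewise for \<open>q\<close> and \<open>y\<close>.
\<close>

lemma adjacent_conc_index:
  assumes "adjacent (p \<frown> x) (q \<frown> y)" and "\<And>b. x \<noteq> (\<lambda>_. b)" "\<And>b. y \<noteq> (\<lambda>_. b)"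
  obtains n where "length p \<le> n" "length q \<le> n" "\<And>i. i < n \<Longrightarrow> (p \<frown> x) i = (q \<frown> y) i"
    "\<And>i. n - length p < i \<Longrightarrow> x i \<noteq> x (n - length p)"
    "\<And>i. n - length q < i \<Longrightarrow> y i \<noteq> y (n - length q)"
proof -
  obtain n where n: "\<forall>i<n. (p \<frown> x) i = (q \<frown> y) i" "(p \<frown> x) n \<noteq> (q \<frown> y) n"
    "\<forall>i>n. (p \<frown> x) i = (q \<frown> y) n \<and> (q \<frown> y) i = (p \<frown> x) n"
    using assms(1) unfolding adjacent_def by blast
  have x: "x i = (p \<frown> x) (length p + i)" and y: "y i = (q \<frown> y) (length q + i)" for i
    by simp_all
  have p: "length p \<le> n"
  proof (rule ccontr)
    assume "\<not> length p \<le> n"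
    then have "n < length p + i" for i by linarith
    then have "x = (\<lambda>_. (q \<frown> y) n)" using n(3) x by (intro ext) metis
    then show False using assms(2) by blast
  qed
  have q: "length q \<le> n"
  proof (rule ccontr)
    assume "\<not> length q \<le> n"
    then have "n < length q + i" for i by linarith
    then have "y = (\<lambda>_. (p \<frown> x) n)" using n(3) y by (intro ext) metis
    then show False using assms(3) by blast
  qed
  show thesis
  proof (rule that [OF p q])
    show "(p \<frown> x) i = (q \<frown> y) i" if "i < n" for i using n(1) that by blast
    show "x i \<noteq> x (n - length p)" if "n - length p < i" for i
    proof -
      have "n < length p + i" "length p + (n - length p) = n" using that p by linarith+
      then show ?thesis using n(2,3) x [of i] x [of "n - length p"] by metis
    qed
    show "y i \<noteq> y (n - length q)" if "n - length q < i" for i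
    proof -
      have "n < length q + i" "length q + (n - length q) = n" using that q by linarith+
      then show ?thesis using n(2,3) y [of i] y [of "n - length q"] by metis
    qed
  qed
qed

text \<open>
  As \<open>x\<close> and \<open>y\<close> are not constant, the sequences part within \<open>x\<close> and \<open>y\<close>, at the last change of letter in
  each. This determines the difference of the lengths of \<open>p\<close> and \<open>q\<close>. One of the two words is empty,
  and the other one is a prefix of \<open>x\<close> or \<open>y\<close>.
\<close>

lemma adjacent_conc_determined:
  assumes adj: "adjacent (p \<frown> x) (q \<frown> y)" "adjacent (p' \<frown> x) (q' \<frown> y)"
    and nonconst: "\<And>b. x \<noteq> (\<lambda>_. b)" "\<And>b. y \<noteq> (\<lambda>_. b)"
    and nil: "p = [] \<or> q = []" "p' = [] \<or> q' = []"
  shows "p = p' \<and> q = q'"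
proof -
  obtain n where n: "length p \<le> n" "length q \<le> n" "\<And>i. i < n \<Longrightarrow> (p \<frown> x) i = (q \<frown> y) i"
    "\<And>i. n - length p < i \<Longrightarrow> x i \<noteq> x (n - length p)"
    "\<And>i. n - length q < i \<Longrightarrow> y i \<noteq> y (n - length q)"
    using adjacent_conc_index [OF adj(1) nonconst] by blast
  obtain m where m: "length p' \<le> m" "length q' \<le> m" "\<And>i. i < m \<Longrightarrow> (p' \<frown> x) i = (q' \<frown> y) i"
    "\<And>i. m - length p' < i \<Longrightarrow> x i \<noteq> x (m - length p')"
    "\<And>i. m - length q' < i \<Longrightarrow> y i \<noteq> y (m - length q')"
    using adjacent_conc_index [OF adj(2) nonconst] by blast
  have last_change: "i = j" if "\<And>l. i < l \<Longrightarrow> z l \<noteq> z i" "\<And>l. j < l \<Longrightarrow> z l \<noteq> z j"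
    for i j and z :: seq
    using that(1) [of j] that(1) [of "Suc j"] that(1) [of "Suc i"]
      that(2) [of i] that(2) [of "Suc i"] that(2) [of "Suc j"]
    by (cases i j rule: linorder_cases) auto
  have "n - length p = m - length p'" "n - length q = m - length q'"
    using last_change [of "n - length p" x "m - length p'"] n(4) m(4)
      last_change [of "n - length q" y "m - length q'"] n(5) m(5) by blast+
  moreover have "length p = 0 \<or> length q = 0" "length p' = 0 \<or> length q' = 0"
    using nil by auto
  ultimately have len: "length p = length p'" "length q = length q'" "n = m"
    using n(1,2) m(1,2) by linarith+
  show ?thesis
  proof (cases "p = []")
    case True
    have "q ! i = q' ! i" if "i < length q" for i
      using n(3) [of i] m(3) [of i] n(2) m(2) that len True by simp
    then show ?thesis using True len by (auto intro: nth_equalityI)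
  next
    case False
    then have "q = []" using nil by blast
    have "p ! i = p' ! i" if "i < length p" for i
      using n(3) [of i] m(3) [of i] n(1) m(1) that len \<open>q = []\<close> by simp
    then show ?thesis using \<open>q = []\<close> len by (auto intro: nth_equalityI)
  qed
qed

lemma TO2_cases:
  assumes "T \<in> TO2"
  obtains U :: "nat transducer" where "T \<in> SO2" "U \<in> SO2"
    "iso (product T U) id_transducer" "iso (product U T) id_transducer"
    "\<And>t. t \<in> states T \<Longrightarrow> monotone less_fun less_fun (induced T t) \<or>
      monotone less_fun (\<lambda>x y. less_fun y x) (induced T t)"
  using assms unfolding TO2_def O2_def by blast

theorem theorem3p9:
  fixes T :: "'s transducer"
  assumes "T \<in> TO2"
  shows "card (states T) = 1"
proof (rule ccontr)
  assume card: "card (states T) \<noteq> 1"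
  obtain U :: "nat transducer" where T: "T \<in> SO2" and U: "U \<in> SO2"
    and TU: "iso (product T U) id_transducer" and UT: "iso (product U T) id_transducer"
    and mono: "\<And>t. t \<in> states T \<Longrightarrow> monotone less_fun less_fun (induced T t) \<or>
      monotone less_fun (\<lambda>x y. less_fun y x) (induced T t)"
    using TO2_cases [OF assms] by blast
  note T' = SO2_D [OF T] and U' = SO2_D [OF U]

  obtain u1 t1 c1 where UT1: "u1 \<in> states U" "t1 \<in> states T"
    "\<And>x. induced T t1 (induced U u1 x) = c1 \<frown> x"
    using product_iso_identityD [OF U'(1) T'(1) U'(3) T'(3) UT] by blast
  have adj: "adjacent (induced T s x) (induced T s y)" if "s \<in> states T" "adjacent x y" for s x y
    by (rule adjacent_induced [OF T'(1,2) U'(1) UT1(2,1) that(1) UT1(3) U'(4) [OF UT1(1)]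
        mono [OF UT1(2)] that(2)])

  obtain s s' where s: "s \<in> states T" "s' \<in> states T" "s \<noteq> s'" "\<And>a. step T a s = step T a s'"
    and disj: "\<And>p q. p \<in> states T \<Longrightarrow> q \<in> states T \<Longrightarrow> step T True p \<noteq> step T False q"
    using SO2_distinct_states_with_same_successors [OF T card] by blast

  obtain t0 u0 c0 where TU0: "t0 \<in> states T" "u0 \<in> states U"
    "\<And>x. induced U u0 (induced T t0 x) = c0 \<frown> x"
    using product_iso_identityD [OF T'(1) U'(1) T'(3) U'(3) TU] by blast
  have step: "step T a p \<in> states T" if "p \<in> states T" for a p
    using that T'(1) by (simp add: transducer_def)
  have nonconst: "induced T (step T (\<not> a) p) (\<lambda>_. a) \<noteq> (\<lambda>_. b)" if p: "p \<in> states T" for a b p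
  proof -
    let ?r = "step T (\<not> a) p"
    obtain w where w: "step_word T w t0 = ?r"
      using T'(2) TU0(1) step [OF p] unfolding strongly_connected_def by blast
    let ?u = "step_word U (out_word T w t0) u0"
    have u: "?u \<in> states U" by (rule step_word_in_states [OF U'(1) TU0(2)])
    obtain c where c: "\<And>x. induced U ?u (induced T ?r x) = c \<frown> x"
      using inverse_at_successor [OF T'(1) U'(1) TU0, of w] unfolding w by blast
    obtain K where K: "sync_level U K" using U'(6) by blast
    interpret left_inverse_state T U ?r ?u c K
      by unfold_locales (fact T step [OF p] U'(1) u U'(3) [OF u] K c)+
    show ?thesis
      using constant_input_not_constant_output [OF disj adj [OF _ adjacent_middle] p refl] .
  qed

  let ?x = "induced T (step T False s) (\<lambda>_. True)"
  let ?y = "induced T (step T True s) (\<lambda>_. False)"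
  have x: "?x \<noteq> (\<lambda>_. b)" and y: "?y \<noteq> (\<lambda>_. b)" for b
    using nonconst [OF s(1), of True b] nonconst [OF s(1), of False b] by simp_all
  have ind: "induced T q ([a] \<frown> z) = out T a q \<frown> induced T (step T a q) z" if "q \<in> states T" for q a z
    using induced_conc [OF T'(1) that, of "[a]" z] by simp
  have out_adj: "adjacent (out T False q \<frown> ?x) (out T True q \<frown> ?y)" if "q = s \<or> q = s'" for q
    using that adj [OF s(1) adjacent_middle [of False]] adj [OF s(2) adjacent_middle [of False]]
    by (auto simp: ind s)
  \<comment> \<open>If both outputs were non-empty, then they would begin with the same letter, since the images
    part only beyond them; this letter would be common to all values of the map of \<open>q\<close>.\<close>
  have out_nil: "out T False q = [] \<or> out T True q = []" if q: "q = s \<or> q = s'" for q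
  proof (rule ccontr)
    assume ne: "\<not> (out T False q = [] \<or> out T True q = [])"
    have q_in: "q \<in> states T" using q s by blast
    obtain n where n: "length (out T False q) \<le> n"
      "\<And>i. i < n \<Longrightarrow> (out T False q \<frown> ?x) i = (out T True q \<frown> ?y) i"
      by (rule adjacent_conc_index [OF out_adj [OF q] x y]) (rule that)
    define d where "d = out T False q ! 0"
    have "0 < n" using n(1) ne by (cases "out T False q") auto
    then have d: "out T a q \<noteq> [] \<and> out T a q ! 0 = d" for a
      using n(2) [of 0] ne by (cases a) (auto simp: d_def)
    have "induced T q z = [d] \<frown> suffix 1 (induced T q z)" for z
    proof -
      have "z = [z 0] \<frown> suffix 1 z" using prefix_suffix [of z 1] by simp
      then have "induced T q z = out T (z 0) q \<frown> induced T (step T (z 0) q) (suffix 1 z)"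
        using ind [OF q_in] by metis
      then have "induced T q z 0 = d" using d by simp
      then show ?thesis using prefix_suffix [of "induced T q z" 1] by simp
    qed
    then have "[d] = []" by (rule SO2_no_common_prefix [OF T q_in])
    then show False by simp
  qed
  have "out T False s = out T False s' \<and> out T True s = out T True s'"
    by (rule adjacent_conc_determined [OF out_adj out_adj x y out_nil out_nil]) simp_all
  then have "out T a s = out T a s'" for a by (cases a) auto
  then have "induced T s z = induced T s' z" for z
    using ind [OF s(1), of "z 0" "suffix 1 z"] ind [OF s(2), of "z 0" "suffix 1 z"] s(4)
      prefix_suffix [of z 1] by simp
  then have "s = s'"
    using SO2_state_eqI [OF T s(1,2), of "[]" "[]"] by simp
  with s(3) show False by simp
qed

end
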